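(* Let $\Phi\subset\mathbb{R}^d$ be a lattice such that $H\subseteq G_\Phi$, where $H$ is the group generated by the coordinate reflections, and suppose $F:\mathbb{R}^d\to(-\infty,\infty]$ is $S_\Phi$-invariant. Let $a_1\mathbb{Z}\times\cdots\times a_d\mathbb{Z}$ ($a_i>0$) be a rectangular sublattice of $\Phi$, with associated change of variables $T=T_{a_1,\dots,a_d}$ and polynomials $P_v^\Phi$. Let $(c_v)_{v\in W_\Phi}$ be real numbers with $c_v\ge0$ for all nonzero $v\in W_\Phi$ and $\sum_{v\in W_\Phi}c_v<\infty$, such that $\tilde g:=c_0+\sum_{v\in W_\Phi\setminus\{0\}}c_vP^\Phi_v$ satisfies $\tilde g\le\tilde F$ on $\tilde\Delta_\Phi=T(\Delta_\Phi)$. Let $\Lambda\subset\mathbb{R}^d$ be a lattice with $\Phi\subseteq\Lambda$ and $G_\Phi\subseteq G_\Lambda$, and let $m\in\mathbb{N}$, $m\ge1$. Then the configuration $\omega(\Phi,\frac1m\Lambda)$ is $F$-optimal if (1) $c_v=0$ for all nonzero $v\in(m\Lambda^* )\cap W_\Phi$, and (2) $\tilde g(t)=\tilde F(t)$ for all $t\in T\big((\tfrac1m\Lambda)\cap\Delta_\Phi\big)\setminus\{\mathbf 1\}$, where $\mathbf 1=(1,\dots,1)\in\mathbb{R}^d$.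
   Context: A lattice is $\Phi=V\mathbb{Z}^d$, $V$ nonsingular; $\Phi^*=\{v: w\cdot v\in\mathbb{Z}\ \forall w\in\Phi\}$. $S_\Phi$ is the group of isometries of $\mathbb{R}^d$ mapping $\Phi$ onto itself, and $G_\Phi\subset O(d)$ is its subgroup fixing the origin. $H$ is the group of order $2^d$ generated by the reflections $R_j(x_1,\dots,x_j,\dots,x_d)=(x_1,\dots,-x_j,\dots,x_d)$, $j=1,\dots,d$. $W_\Phi$ denotes a choice of fundamental domain for $\Phi^*/G_\Phi$ (exactly one point from each $G_\Phi$-orbit in $\Phi^*$), and $\Delta_\Phi$ a choice of fundamental domain for $\mathbb{R}^d/S_\Phi$. Any lattice $\Phi$ with $H\subseteq G_\Phi$ contains a rectangular lattice $a_1\mathbb{Z}\times\cdots\times a_d\mathbb{Z}$. The associated change of variables is $T_{a_1,\dots,a_d}(x_1,\dots,x_d)=(\cos(2\pi x_1/a_1),\dots,\cos(2\pi x_d/a_d))\in[-1,1]^d$. For a function $h$ on $\mathbb{R}^d$ that is $(a_1\mathbb{Z}\times\cdots\times a_d\mathbb{Z})$-periodic and $H$-invariant, $\tilde h(t)=h\big(\tfrac{a_1\arccos t_1}{2\pi},\dots,\tfrac{a_d\arccos t_d}{2\pi}\big)$ for $t\in[-1,1]^d$, so that $\tilde h(T(x))=h(x)$. For $v\in\Phi^*$ let $C_v(x)=\frac1{|G_\Phi|}\sum_{\sigma\in G_\Phi}e^{2\pi i(\sigma v)\cdot x}$, and let $P_v^\Phi=\tilde C_v$, which is a polynomial in $t_1,\dots,t_d$.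 For lattices $\Phi\subseteq\Lambda'$, $\omega(\Phi,\Lambda')$ denotes a set of representatives of the cosets of $\Phi$ in $\Lambda'$, e.g. $\Lambda'\cap\Omega_\Phi$ with $\Omega_\Phi=V[0,1)^d$. An $n$-point configuration is a multiset of cardinality $n$ in $\mathbb{R}^d$; $E_F(\omega_n)=\sum_{i}\sum_{j\ne i}F(x_i-x_j)$; $\omega_n$ is $F$-optimal if $E_F(\omega_n)\le E_F(\omega_n')$ for every $n$-point configuration $\omega_n'\subset\mathbb{R}^d$. *)

theory Defs
  imports "HOL-Analysis.Analysis" "HOL-Library.Multiset" "HOL-Algebra.Bij"
    "HOL-Algebra.Generated_Groups"
begin

definition is_lattice :: "(real^'n) set \<Rightarrow> bool" where
  "is_lattice \<Phi> \<longleftrightarrow>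
     (\<exists>V :: real^'n^'n. invertible V \<and> \<Phi> = (\<lambda>z. V *v z) ` {z. \<forall>i. z $ i \<in> \<int>})"

definition dual_lattice :: "(real^'n) set \<Rightarrow> (real^'n) set" where
  "dual_lattice \<Phi> = {v. \<forall>w\<in>\<Phi>. w \<bullet> v \<in> \<int>}"

definition scaled :: "real \<Rightarrow> (real^'n) set \<Rightarrow> (real^'n) set" where
  "scaled r A = (\<lambda>x. r *\<^sub>R x) ` A"

definition rect_lattice :: "real^'n \<Rightarrow> (real^'n) set" where
  "rect_lattice a = {x. \<forall>i. \<exists>k::int. x $ i = a $ i * of_int k}"

(* A distance-preserving self-map of a Euclidean space is automatically bijective. *)
definition isometry_group :: "(real^'n) set \<Rightarrow> (real^'n \<Rightarrow> real^'n) set" where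
  "isometry_group \<Phi> = {f. (\<forall>x y. dist (f x) (f y) = dist x y) \<and> f ` \<Phi> = \<Phi>}"

definition point_group :: "(real^'n) set \<Rightarrow> (real^'n \<Rightarrow> real^'n) set" where
  "point_group \<Phi> = {\<sigma> \<in> isometry_group \<Phi>. \<sigma> 0 = 0}"

definition coord_reflection :: "'n \<Rightarrow> real^'n \<Rightarrow> real^'n" where
  "coord_reflection j x = (\<chi> i. if i = j then - (x $ i) else x $ i)"

definition reflection_group :: "(real^'n \<Rightarrow> real^'n) set" where
  "reflection_group = generate (BijGroup UNIV) (range coord_reflection)"

definition fundamental_domain :: "('a \<Rightarrow> 'a) set \<Rightarrow> 'a set \<Rightarrow> 'a set \<Rightarrow> bool" where
  "fundamental_domain G X D \<longleftrightarrow> D \<subseteq> X \<and> (\<forall>x\<in>X. \<exists>!y. y \<in> D \<and> (\<exists>f\<in>G. y = f x))"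

definition coset_reps :: "(real^'n) set \<Rightarrow> (real^'n) set \<Rightarrow> (real^'n) set \<Rightarrow> bool" where
  "coset_reps \<Phi> \<Lambda> R \<longleftrightarrow> R \<subseteq> \<Lambda> \<and> (\<forall>x\<in>\<Lambda>. \<exists>!y. y \<in> R \<and> x - y \<in> \<Phi>)"

definition cos_map :: "real^'n \<Rightarrow> real^'n \<Rightarrow> real^'n" where
  "cos_map a x = (\<chi> i. cos (2 * pi * x $ i / a $ i))"

(* Only meaningful for t in the cube [-1,1]^d, which contains the range of cos_map a. *)
definition tilde :: "real^'n \<Rightarrow> (real^'n \<Rightarrow> 'b) \<Rightarrow> real^'n \<Rightarrow> 'b" where
  "tilde a h t = h (\<chi> i. a $ i * arccos (t $ i) / (2 * pi))"

definition sym_exp :: "(real^'n) set \<Rightarrow> real^'n \<Rightarrow> real^'n \<Rightarrow> complex" where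
  "sym_exp \<Phi> v x =
     (\<Sum>\<sigma>\<in>point_group \<Phi>. exp (2 * pi * \<i> * complex_of_real (\<sigma> v \<bullet> x)))
       / of_nat (card (point_group \<Phi>))"

definition lattice_poly :: "(real^'n) set \<Rightarrow> real^'n \<Rightarrow> real^'n \<Rightarrow> real^'n \<Rightarrow> complex" where
  "lattice_poly \<Phi> a v = tilde a (sym_exp \<Phi> v)"

(* Taking real parts loses nothing, see lattice_poly_real below. *)
definition lp_function ::
    "(real^'n) set \<Rightarrow> real^'n \<Rightarrow> (real^'n) set \<Rightarrow> (real^'n \<Rightarrow> real) \<Rightarrow> real^'n \<Rightarrow> real" where
  "lp_function \<Phi> a W c t = c 0 + (\<Sum>\<^sub>\<infinity>v\<in>W - {0}. c v * Re (lattice_poly \<Phi> a v t))"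

(* Ordered pairs of distinct indices: repeated points contribute F 0. *)
definition energy :: "(real^'n \<Rightarrow> ereal) \<Rightarrow> (real^'n) multiset \<Rightarrow> ereal" where
  "energy F \<omega> = (\<Sum>x\<in>#\<omega>. \<Sum>y\<in>#\<omega> - {#x#}. F (x - y))"

definition F_optimal :: "(real^'n \<Rightarrow> ereal) \<Rightarrow> (real^'n) multiset \<Rightarrow> bool" where
  "F_optimal F \<omega> \<longleftrightarrow> (\<forall>\<omega>'. size \<omega>' = size \<omega> \<longrightarrow> energy F \<omega> \<le> energy F \<omega>')"

lemma is_lattice_uminus:
  fixes \<Phi> :: "(real^'n) set"
  assumes "is_lattice \<Phi>"
  shows "uminus ` \<Phi> = \<Phi>"
proof -
  have *: "- x \<in> \<Phi>" if x: "x \<in> \<Phi>" for x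
  proof -
    obtain V :: "real^'n^'n" where V: "\<Phi> = (\<lambda>z. V *v z) ` {z. \<forall>i. z $ i \<in> \<int>}"
      using assms unfolding is_lattice_def by blast
    obtain z where z: "x = V *v z" "\<forall>i. z $ i \<in> \<int>"
      using x V by blast
    have "- x = V *v (- z)"
      using z(1) using matrix_vector_mult_diff_distrib[of V 0 z] by simp
    then show ?thesis
      using z(2) unfolding V by (intro image_eqI[of _ _ "- z"]) auto
  qed
  show ?thesis
  proof
    show "uminus ` \<Phi> \<subseteq> \<Phi>" using * by blast
    show "\<Phi> \<subseteq> uminus ` \<Phi>"
      using * by (metis image_eqI minus_minus subsetI)
  qed
qed

lemma point_group_uminus:
  fixes \<Phi> :: "(real^'n) set"
  assumes "is_lattice \<Phi>" "\<sigma> \<in> point_group \<Phi>"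
  shows "(\<lambda>x. - \<sigma> x) \<in> point_group \<Phi>"
proof -
  have "\<sigma> ` \<Phi> = \<Phi>"
    using assms(2) by (auto simp: point_group_def isometry_group_def)
  then have "(\<lambda>x. - \<sigma> x) ` \<Phi> = \<Phi>"
    using is_lattice_uminus[OF assms(1)] by (metis image_image)
  then show ?thesis
    using assms(2) by (simp add: point_group_def isometry_group_def dist_minus)
qed

lemma sym_exp_real:
  fixes \<Phi> :: "(real^'n) set"
  assumes "is_lattice \<Phi>"
  shows "sym_exp \<Phi> v x \<in> \<real>"
proof -
  let ?e = "\<lambda>\<sigma>. exp (2 * pi * \<i> * complex_of_real (\<sigma> v \<bullet> x))"
  have "cnj (\<Sum>\<sigma>\<in>point_group \<Phi>. ?e \<sigma>) = (\<Sum>\<sigma>\<in>point_group \<Phi>. ?e (\<lambda>y. - \<sigma> y))"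
    by (simp add: exp_cnj)
  also have "\<dots> = (\<Sum>\<sigma>\<in>point_group \<Phi>. ?e \<sigma>)"
    by (rule sum.reindex_bij_witness[where i = "\<lambda>\<sigma> y. - \<sigma> y" and j = "\<lambda>\<sigma> y. - \<sigma> y"])
      (auto intro: point_group_uminus[OF assms])
  finally have "(\<Sum>\<sigma>\<in>point_group \<Phi>. ?e \<sigma>) \<in> \<real>"
    by (simp add: Reals_cnj_iff)
  then show ?thesis
    unfolding sym_exp_def by (intro Reals_divide) auto
qed

lemma lattice_poly_real:
  fixes \<Phi> :: "(real^'n) set"
  assumes "is_lattice \<Phi>"
  shows "complex_of_real (Re (lattice_poly \<Phi> a v t)) = lattice_poly \<Phi> a v t"
  using sym_exp_real[OF assms] by (simp add: lattice_poly_def tilde_def of_real_Re)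

end

theory Submission
  imports Defs
begin

text \<open>
  The series \<open>g = c\<^sub>0 + \<Sum> c\<^sub>v C\<^sub>v\<close> is invariant under all isometries of \<open>\<Phi>\<close>, so the hypotheses on
  \<open>T(\<Delta>)\<close> spread to \<open>g \<le> F\<close> on the whole space, with equality on \<open>(1/m)\<Lambda> - \<Phi>\<close>.  Summing \<open>C\<^sub>v(x - y)\<close>
  over all pairs of an \<open>N\<close>-point configuration gives an average of squared moduli of exponential
  sums, hence \<open>E\<^sub>F \<ge> E\<^sub>g \<ge> c\<^sub>0 N\<^sup>2 - N g(0)\<close>.  For coset representatives of \<open>\<Phi>\<close> in \<open>(1/m)\<Lambda>\<close> both
  inequalities are equalities: where \<open>c\<^sub>v \<noteq> 0\<close>, the exponential sums run over a nontrivial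
  character of \<open>(1/m)\<Lambda>/\<Phi>\<close> and vanish.
\<close>

subsection \<open>Lattices\<close>

lemma lattice_zero: "is_lattice L \<Longrightarrow> 0 \<in> L"
  unfolding is_lattice_def by (force intro: image_eqI[of _ _ 0])

lemma lattice_diff:
  assumes "is_lattice L" "x \<in> L" "y \<in> L"
  shows "x - y \<in> L"
proof -
  obtain V :: "real^'a^'a" where V: "L = (\<lambda>z. V *v z) ` {z. \<forall>i. z $ i \<in> \<int>}"
    using assms(1) unfolding is_lattice_def by blast
  obtain z w where z: "x = V *v z" "\<forall>i. z $ i \<in> \<int>" and w: "y = V *v w" "\<forall>i. w $ i \<in> \<int>"
    using assms(2,3) V by blast
  have "x - y = V *v (z - w)"
    using z w by (simp add: matrix_vector_mult_diff_distrib)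
  then show ?thesis
    using z w unfolding V by (intro image_eqI[of _ _ "z - w"]) auto
qed

lemma lattice_uminus: "is_lattice L \<Longrightarrow> x \<in> L \<Longrightarrow> - x \<in> L"
  using lattice_diff[of L 0 x] lattice_zero[of L] by simp

lemma lattice_add: "is_lattice L \<Longrightarrow> x \<in> L \<Longrightarrow> y \<in> L \<Longrightarrow> x + y \<in> L"
  using lattice_diff[of L x "- y"] lattice_uminus by fastforce

lemma lattice_scale_nat: "is_lattice L \<Longrightarrow> x \<in> L \<Longrightarrow> real k *\<^sub>R x \<in> L"
  by (induction k) (auto simp: lattice_zero lattice_add algebra_simps)

lemma is_lattice_scaled:
  assumes "is_lattice L" "r \<noteq> 0"
  shows "is_lattice (scaled r L)"
proof -
  obtain V :: "real^'a^'a" where inv: "invertible V"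
    and V: "L = (\<lambda>z. V *v z) ` {z. \<forall>i. z $ i \<in> \<int>}"
    using assms(1) unfolding is_lattice_def by blast
  have "scaled r L = (\<lambda>z. (r *\<^sub>R V) *v z) ` {z. \<forall>i. z $ i \<in> \<int>}"
    unfolding scaled_def V by (simp add: image_image scaleR_matrix_vector_assoc)
  moreover have "invertible (r *\<^sub>R V)"
    using inv assms(2) by (rule scalar_invertible[rotated])
  ultimately show ?thesis
    unfolding is_lattice_def by blast
qed

lemma lattice_subset_scaled:
  assumes "is_lattice L" "m \<ge> 1"
  shows "L \<subseteq> scaled (1 / real m) L"
proof
  fix x assume "x \<in> L"
  then have "real m *\<^sub>R x \<in> L" "x = (1 / real m) *\<^sub>R (real m *\<^sub>R x)"
    using assms by (auto intro: lattice_scale_nat)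
  then show "x \<in> scaled (1 / real m) L"
    unfolding scaled_def by blast
qed

section \<open>Discreteness of lattices and finiteness of coset representatives\<close>

lemma finite_int_vectors_bounded: "finite {z :: real^'n. (\<forall>i. z $ i \<in> \<int>) \<and> norm z \<le> C}"
proof -
  let ?S = "{k :: real. k \<in> \<int> \<and> \<bar>k\<bar> \<le> C}"
  have "finite (Pi\<^sub>E (UNIV :: 'n set) (\<lambda>_. ?S))"
    by (intro finite_PiE) (auto simp: finite_abs_int_segment)
  moreover have "{z :: real^'n. (\<forall>i. z $ i \<in> \<int>) \<and> norm z \<le> C} \<subseteq> vec_lambda ` Pi\<^sub>E UNIV (\<lambda>_. ?S)"
  proof
    fix z :: "real^'n" assume z: "z \<in> {z. (\<forall>i. z $ i \<in> \<int>) \<and> norm z \<le> C}"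
    then have "\<bar>z $ i\<bar> \<le> C" for i
      using component_le_norm_cart[of z i] by simp
    then show "z \<in> vec_lambda ` Pi\<^sub>E UNIV (\<lambda>_. ?S)"
      using z by (intro image_eqI[of _ _ "vec_nth z"]) (auto simp: vec_nth_inverse)
  qed
  ultimately show ?thesis
    by (rule finite_surj)
qed

text \<open>The inverse of the basis matrix is a bounded linear map, so it carries the lattice
  points in \<open>B\<close> to integer vectors of bounded norm.\<close>

lemma finite_lattice_inter_bounded:
  fixes L :: "(real^'n) set"
  assumes "is_lattice L" "bounded B"
  shows "finite (L \<inter> B)"
proof -
  obtain V :: "real^'n^'n" where inv: "invertible V"
    and V: "L = (\<lambda>z. V *v z) ` {z. \<forall>i. z $ i \<in> \<int>}"
    using assms(1) unfolding is_lattice_def by blast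
  obtain V' where V': "V' ** V = mat 1"
    using inv invertible_def by blast
  have inv': "V' *v (V *v z) = z" for z
    by (simp add: matrix_vector_mul_assoc V')
  have "bounded ((\<lambda>x. V' *v x) ` B)"
    using assms(2) by (rule bounded_linear_image) (rule matrix_vector_mul_bounded_linear)
  then obtain C where C: "norm (V' *v x) \<le> C" if "x \<in> B" for x
    unfolding bounded_iff by auto
  have "L \<inter> B \<subseteq> (\<lambda>z. V *v z) ` {z. (\<forall>i. z $ i \<in> \<int>) \<and> norm z \<le> C}"
    using C inv' unfolding V by fastforce
  then show ?thesis
    using finite_int_vectors_bounded finite_surj by blast
qed

text \<open>Taking fractional parts of the coordinates in a lattice basis moves \<open>x\<close> by
  a lattice vector into the closed unit cell, a bounded set.\<close>

lemma lattice_reduce_bounded: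
  fixes L :: "(real^'n) set"
  assumes "is_lattice L"
  obtains B where "bounded B" "\<And>x. \<exists>y\<in>B. x - y \<in> L"
proof -
  obtain V :: "real^'n^'n" where inv: "invertible V"
    and V: "L = (\<lambda>z. V *v z) ` {z. \<forall>i. z $ i \<in> \<int>}"
    using assms unfolding is_lattice_def by blast
  obtain V' where V': "V ** V' = mat 1"
    using inv invertible_def by blast
  let ?B = "(\<lambda>z. V *v z) ` cbox 0 1"
  have "bounded ?B"
    using bounded_cbox by (rule bounded_linear_image) (rule matrix_vector_mul_bounded_linear)
  moreover have "\<exists>y\<in>?B. x - y \<in> L" for x
  proof -
    define z where "z = V' *v x"
    define f :: "real^'n" where "f = (\<chi> i. frac (z $ i))"
    have "x = V *v z"
      by (simp add: z_def matrix_vector_mul_assoc V')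
    then have "x - V *v f = V *v (z - f)"
      by (simp add: matrix_vector_mult_diff_distrib)
    moreover have "\<forall>i. (z - f) $ i \<in> \<int>"
      by (simp add: f_def frac_def)
    moreover have "f \<in> cbox 0 1"
      by (simp add: f_def mem_box_cart less_imp_le[OF frac_lt_1])
    ultimately show ?thesis
      unfolding V by blast
  qed
  ultimately show thesis
    using that by blast
qed

text \<open>Reduction modulo \<open>\<Phi>\<close> sends \<open>R\<close> into the intersection of
  \<open>L\<close> with a bounded set, which is finite. It is injective on \<open>R\<close> because
  distinct representatives are incongruent modulo \<open>\<Phi>\<close>.\<close>

lemma finite_coset_reps:
  fixes \<Phi> L R :: "(real^'n) set"
  assumes "is_lattice \<Phi>" "is_lattice L" "\<Phi> \<subseteq> L" "coset_reps \<Phi> L R"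
  shows "finite R"
proof -
  obtain B where B: "bounded B" "\<And>x. \<exists>y\<in>B. x - y \<in> \<Phi>"
    using lattice_reduce_bounded[OF assms(1)] by blast
  obtain r where r: "r x \<in> B" "x - r x \<in> \<Phi>" for x
    using B(2) by metis
  have "r ` R \<subseteq> L \<inter> B"
  proof
    fix y assume "y \<in> r ` R"
    then obtain x where x: "x \<in> R" "y = r x" by blast
    have "x \<in> L" "x - r x \<in> L"
      using assms(3,4) x r[of x] by (auto simp: coset_reps_def)
    then have "x - (x - r x) \<in> L"
      by (rule lattice_diff[OF assms(2)])
    then show "y \<in> L \<inter> B" using x r[of x] by simp
  qed
  then have "finite (r ` R)"
    using finite_lattice_inter_bounded[OF assms(2) B(1)] finite_subset by blast
  moreover have "inj_on r R"
  proof
    fix x y assume xy: "x \<in> R" "y \<in> R" "r x = r y"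
    have "x - y = (x - r x) - (y - r y)" using xy by simp
    then have "x - y \<in> \<Phi>"
      using lattice_diff[OF assms(1) r(2)[of x] r(2)[of y]] by simp
    moreover have "x - x \<in> \<Phi>"
      using lattice_zero[OF assms(1)] by simp
    moreover have "x \<in> L" using assms(4) xy by (auto simp: coset_reps_def)
    ultimately show "x = y"
      using assms(4) xy unfolding coset_reps_def by metis
  qed
  ultimately show ?thesis
    using finite_imageD by blast
qed

subsection \<open>Isometries of a lattice\<close>

text \<open>An isometry fixing the origin is linear and preserves inner products. Linearity and
  bijectivity of point group elements are drawn from this fact.\<close>

lemma point_group_orthogonal:
  "\<sigma> \<in> point_group L \<Longrightarrow> orthogonal_transformation \<sigma>"
  by (simp add: point_group_def isometry_group_def orthogonal_transformation_isometry)

lemma point_group_image: "\<sigma> \<in> point_group L \<Longrightarrow> \<sigma> ` L = L"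
  by (simp add: point_group_def isometry_group_def)

lemma point_group_inner: "\<sigma> \<in> point_group L \<Longrightarrow> \<sigma> x \<bullet> \<sigma> y = x \<bullet> y"
  using point_group_orthogonal orthogonal_transformation_def by blast

lemma point_group_bij: "\<sigma> \<in> point_group L \<Longrightarrow> bij \<sigma>"
  using point_group_orthogonal orthogonal_transformation_bij by blast

lemma point_group_iff:
  "\<sigma> \<in> point_group L \<longleftrightarrow> orthogonal_transformation \<sigma> \<and> \<sigma> ` L = L"
  by (auto simp: point_group_def isometry_group_def orthogonal_transformation_isometry)

lemma point_group_comp:
  assumes "\<sigma> \<in> point_group L" "\<tau> \<in> point_group L"
  shows "\<sigma> \<circ> \<tau> \<in> point_group L"
proof -
  have "(\<sigma> \<circ> \<tau>) ` L = \<sigma> ` \<tau> ` L"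
    by (rule image_comp[symmetric])
  then show ?thesis
    using assms by (simp add: point_group_iff orthogonal_transformation_compose)
qed

lemma point_group_inv:
  assumes "\<sigma> \<in> point_group L"
  shows "inv_into UNIV \<sigma> \<in> point_group L"
proof -
  have "inv_into UNIV \<sigma> ` \<sigma> ` L = L"
    using point_group_bij[OF assms] by (simp add: bij_is_inj image_inv_f_f)
  then show ?thesis
    using assms by (simp add: point_group_iff orthogonal_transformation_inv)
qed

text \<open>The inverse of an orthogonal map is its adjoint. This moves a symmetry from the point
  \<open>x\<close> to the frequency \<open>v\<close> in \<open>sym_exp\<close>.\<close>

lemma point_group_inner_inv:
  assumes "\<sigma> \<in> point_group L"
  shows "inv_into UNIV \<sigma> x \<bullet> y = x \<bullet> \<sigma> y"
  using point_group_inner[OF assms, of "inv_into UNIV \<sigma> x" y] point_group_bij[OF assms]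
  by (simp add: bij_is_surj surj_f_inv_f)

lemma point_group_scaled:
  assumes "\<sigma> \<in> point_group L" "x \<in> scaled r L"
  shows "\<sigma> x \<in> scaled r L"
proof -
  obtain y where y: "y \<in> L" "x = r *\<^sub>R y"
    using assms(2) unfolding scaled_def by blast
  then have "\<sigma> x = r *\<^sub>R \<sigma> y"
    using orthogonal_transformation_linear[OF point_group_orthogonal[OF assms(1)]]
    by (simp add: linear_cmul)
  then show ?thesis
    using point_group_image[OF assms(1)] y unfolding scaled_def by blast
qed

text \<open>Every \<open>w\<close> in \<open>L\<close> is \<open>\<sigma> u\<close> with
  \<open>u\<close> in \<open>L\<close>, so pairing \<open>w\<close> with \<open>\<sigma> v\<close>
  is the same as pairing \<open>u\<close> with \<open>v\<close>.\<close>

lemma point_group_dual: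
  assumes "\<sigma> \<in> point_group L" "v \<in> dual_lattice L"
  shows "\<sigma> v \<in> dual_lattice L"
  unfolding dual_lattice_def
proof (intro CollectI ballI)
  fix w assume "w \<in> L"
  then obtain u where "u \<in> L" "w = \<sigma> u"
    using point_group_image[OF assms(1)] by blast
  then show "w \<bullet> \<sigma> v \<in> \<int>"
    using assms by (simp add: point_group_inner dual_lattice_def)
qed

text \<open>The translation part is \<open>f 0\<close>, which lies in \<open>L\<close> because
  \<open>0\<close> does. Subtracting it leaves an isometry of \<open>L\<close> that fixes the
  origin.\<close>

lemma isometry_group_decompose:
  assumes "is_lattice L" "f \<in> isometry_group L"
  obtains \<sigma> b where "\<sigma> \<in> point_group L" "b \<in> L" "\<And>x. f x = \<sigma> x + b"
proof
  have im: "f ` L = L" and dist: "\<And>x y. dist (f x) (f y) = dist x y"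
    using assms(2) by (auto simp: isometry_group_def)
  show b: "f 0 \<in> L"
    using im lattice_zero[OF assms(1)] by blast
  have "(\<lambda>x. f x - f 0) ` L = L"
  proof
    show "(\<lambda>x. f x - f 0) ` L \<subseteq> L"
      using im b lattice_diff[OF assms(1)] by blast
    show "L \<subseteq> (\<lambda>x. f x - f 0) ` L"
    proof
      fix y assume "y \<in> L"
      then have "y + f 0 \<in> f ` L"
        using im b lattice_add[OF assms(1)] by simp
      then show "y \<in> (\<lambda>x. f x - f 0) ` L"
        by (metis (no_types, lifting) add_diff_cancel_right' image_iff)
    qed
  qed
  then show "(\<lambda>x. f x - f 0) \<in> point_group L"
    using dist by (simp add: point_group_def isometry_group_def dist_norm)
qed simp

lemma isometry_group_compose_translation:
  assumes "is_lattice L" "\<sigma> \<in> point_group L" "b \<in> L"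
  shows "(\<lambda>x. \<sigma> x + b) \<in> isometry_group L"
proof -
  have "(\<lambda>x. \<sigma> x + b) ` L = (\<lambda>x. x + b) ` \<sigma> ` L"
    by (simp add: image_image)
  also have "\<dots> = (\<lambda>x. x + b) ` L"
    by (simp only: point_group_image[OF assms(2)])
  also have "\<dots> = L"
  proof
    show "(\<lambda>x. x + b) ` L \<subseteq> L"
      using lattice_add[OF assms(1)] assms(3) by blast
    show "L \<subseteq> (\<lambda>x. x + b) ` L"
    proof
      fix y assume "y \<in> L"
      then have "y - b \<in> L" "y = (y - b) + b"
        using lattice_diff[OF assms(1) _ assms(3)] by auto
      then show "y \<in> (\<lambda>x. x + b) ` L" by blast
    qed
  qed
  finally show ?thesis
    using assms(2) by (simp add: point_group_def isometry_group_def)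
qed

lemma coord_reflection_in_reflection_group: "coord_reflection j \<in> reflection_group"
  unfolding reflection_group_def by (intro generate.incl) simp

text \<open>Adding an index to \<open>J\<close> composes with one more coordinate reflection. Only
  single reflections are taken from \<open>reflection_group\<close>; their products are formed in
  the point group.\<close>

lemma sign_changes_in_point_group:
  assumes "reflection_group \<subseteq> point_group L" "finite J"
  shows "(\<lambda>x. \<chi> i. if i \<in> J then - (x $ i) else x $ i) \<in> point_group L"
  using assms(2)
proof induction
  case empty
  show ?case by (simp add: point_group_def isometry_group_def)
next
  case (insert j J)
  have "coord_reflection j \<circ> (\<lambda>x. \<chi> i. if i \<in> J then - (x $ i) else x $ i) \<in> point_group L"
    using assms(1) coord_reflection_in_reflection_group insert.IH by (intro point_group_comp) auto
  also have "coord_reflection j \<circ> (\<lambda>x. \<chi> i. if i \<in> J then - (x $ i) else x $ i)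
    = (\<lambda>x. \<chi> i. if i \<in> insert j J then - (x $ i) else x $ i)"
    using insert.hyps by (auto simp: coord_reflection_def fun_eq_iff vec_eq_iff)
  finally show ?case .
qed

text \<open>The point \<open>a arccos(cos(2\<pi>x/a))/(2\<pi>)\<close> is obtained from \<open>x\<close> by sign changes and a
  translation in the rectangular sublattice.\<close>

lemma tilde_cos_map:
  fixes a :: "real^'n"
  assumes "is_lattice \<Phi>" "reflection_group \<subseteq> point_group \<Phi>" "\<And>i. a $ i > 0" "rect_lattice a \<subseteq> \<Phi>"
    and h: "\<And>f x. f \<in> isometry_group \<Phi> \<Longrightarrow> h (f x) = h x"
  shows "tilde a h (cos_map a x) = h x"
proof -
  \<comment> \<open>The arccosine of a cosine is the distance from the angle to some multiple of 2
    pi; \<open>k i\<close> picks that multiple in coordinate \<open>i\<close>.\<close>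
  have "\<exists>k. arccos (cos (2 * pi * x $ i / a $ i)) = \<bar>2 * pi * x $ i / a $ i - of_int k * (2 * pi)\<bar>" for i
    by (metis arccos_cos_eq_abs_2pi)
  then obtain k where k:
    "\<And>i. arccos (cos (2 * pi * x $ i / a $ i)) = \<bar>2 * pi * x $ i / a $ i - of_int (k i) * (2 * pi)\<bar>"
    by metis
  \<comment> \<open>In coordinates scaled by \<open>a\<close>, subtracting these multiples of 2 pi
    is translation by \<open>b\<close>; flipping the signs in \<open>J\<close> then yields the
    absolute values.\<close>
  define b :: "real^'n" where "b = (\<chi> i. a $ i * of_int (- k i))"
  define J where "J = {i. x $ i + b $ i < 0}"
  have "a $ i * arccos (cos (2 * pi * x $ i / a $ i)) / (2 * pi) = \<bar>x $ i + b $ i\<bar>" for i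
  proof -
    have "x $ i + b $ i = a $ i / (2 * pi) * (2 * pi * x $ i / a $ i - of_int (k i) * (2 * pi))"
      using assms(3)[of i] by (simp add: b_def field_simps)
    then have "\<bar>x $ i + b $ i\<bar> = a $ i / (2 * pi) * \<bar>2 * pi * x $ i / a $ i - of_int (k i) * (2 * pi)\<bar>"
      using assms(3)[of i] by (simp add: abs_mult)
    then show ?thesis by (simp add: k)
  qed
  then have "tilde a h (cos_map a x) = h (\<chi> i. \<bar>x $ i + b $ i\<bar>)"
    by (simp add: tilde_def cos_map_def)
  also have "(\<chi> i. \<bar>x $ i + b $ i\<bar>) = (\<lambda>x. \<chi> i. if i \<in> J then - (x $ i) else x $ i) (x + b)"
    by (auto simp: J_def vec_eq_iff)
  also have "h \<dots> = h (x + b)"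
    using sign_changes_in_point_group[OF assms(2)] by (intro h) (auto simp: point_group_def)
  also have "\<dots> = h x"
  proof -
    have "b \<in> \<Phi>"
      \<comment> \<open>\<open>of_int_minus\<close> is disabled so that the integer
        \<open>- k i\<close> stays visible as the witness for \<open>rect_lattice\<close>.\<close>
      using assms(4) unfolding b_def rect_lattice_def by (auto simp del: of_int_minus)
    moreover have "(\<lambda>x. x) \<in> point_group \<Phi>"
      by (simp add: point_group_def isometry_group_def)
    ultimately show ?thesis
      using h[OF isometry_group_compose_translation[OF assms(1), of "\<lambda>x. x" b]] by simp
  qed
  finally show ?thesis .
qed

text \<open>A cosine equals 1 only at multiples of 2 pi. By contraposition, points outside
  \<open>\<Phi>\<close> never map to the excluded corner.\<close>

lemma cos_map_eq_1_imp:
  fixes a :: "real^'n"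
  assumes "\<And>i. a $ i > 0" "cos_map a x = (\<chi> i. 1)"
  shows "x \<in> rect_lattice a"
proof -
  have "\<exists>k::int. x $ i = a $ i * of_int k" for i
  proof -
    have "cos (2 * pi * x $ i / a $ i) = 1"
      using assms(2) by (simp add: cos_map_def vec_eq_iff)
    then obtain k :: int where "2 * pi * x $ i / a $ i = of_int k * 2 * pi"
      unfolding cos_one_2pi_int by blast
    then have "x $ i = a $ i * of_int k"
      using assms(1)[of i] by (simp add: field_simps)
    then show ?thesis by blast
  qed
  then show ?thesis by (simp add: rect_lattice_def)
qed

subsection \<open>Symmetrized exponentials\<close>

text \<open>Conjugation inverts a number of modulus one. The separated variables make the double
  sums over a configuration factor.\<close>

lemma exp_inner_diff:
  fixes v x y :: "real^'n"
  shows "exp (2 * pi * \<i> * complex_of_real (v \<bullet> (x - y)))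
    = exp (2 * pi * \<i> * complex_of_real (v \<bullet> x)) * cnj (exp (2 * pi * \<i> * complex_of_real (v \<bullet> y)))"
  by (simp add: exp_cnj flip: exp_add) (simp add: inner_diff_right algebra_simps)

lemma exp_2pi_i_eq_1_iff: "exp (2 * pi * \<i> * complex_of_real r) = 1 \<longleftrightarrow> r \<in> \<int>"
proof -
  have "exp (2 * pi * \<i> * complex_of_real r) = 1 \<longleftrightarrow> (\<exists>n::int. r = of_int n)"
    unfolding exp_eq_1 by (simp add: field_simps)
  then show ?thesis by (auto elim: Ints_cases)
qed

text \<open>An average of numbers of modulus one. For an infinite group both the sum and the
  cardinality would default to 0, and the bound would still hold.\<close>

lemma norm_sym_exp_le_1: "norm (sym_exp \<Phi> v x) \<le> 1"
proof -
  have "norm (\<Sum>\<sigma>\<in>point_group \<Phi>. exp (2 * pi * \<i> * complex_of_real (\<sigma> v \<bullet> x)))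
     \<le> (\<Sum>\<sigma>\<in>point_group \<Phi>. 1)"
    by (rule sum_norm_le) simp
  then show ?thesis
    by (simp add: sym_exp_def norm_divide divide_le_eq)
qed

text \<open>A translation by \<open>b\<close> in \<open>\<Phi>\<close> multiplies each exponential
  by 1, since \<open>\<sigma> v\<close> is again dual to \<open>\<Phi>\<close>. The linear part
  \<open>\<tau>\<close> permutes the summands, by left multiplication with its inverse.\<close>

lemma sym_exp_isometry_invariant:
  assumes "is_lattice \<Phi>" "v \<in> dual_lattice \<Phi>" "f \<in> isometry_group \<Phi>"
  shows "sym_exp \<Phi> v (f x) = sym_exp \<Phi> v x"
proof -
  obtain \<tau> b where \<tau>: "\<tau> \<in> point_group \<Phi>" and b: "b \<in> \<Phi>" and f: "\<And>x. f x = \<tau> x + b"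
    by (rule isometry_group_decompose[OF assms(1,3)]) (rule that)
  let ?e = "\<lambda>\<sigma> x. exp (2 * pi * \<i> * complex_of_real (\<sigma> v \<bullet> x))"
  have "?e \<sigma> (f x) = ?e (inv_into UNIV \<tau> \<circ> \<sigma>) x" if "\<sigma> \<in> point_group \<Phi>" for \<sigma>
  proof -
    have "\<sigma> v \<bullet> b \<in> \<int>"
      using point_group_dual[OF that assms(2)] b by (simp add: dual_lattice_def inner_commute)
    then have "?e \<sigma> b = 1"
      by (simp only: exp_2pi_i_eq_1_iff)
    moreover have "?e \<sigma> (f x) = ?e \<sigma> (\<tau> x) * ?e \<sigma> b"
      by (simp add: f inner_add_right ring_distribs exp_add)
    ultimately show ?thesis
      by (simp add: point_group_inner_inv[OF \<tau>])
  qed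
  then have "(\<Sum>\<sigma>\<in>point_group \<Phi>. ?e \<sigma> (f x)) = (\<Sum>\<sigma>\<in>point_group \<Phi>. ?e (inv_into UNIV \<tau> \<circ> \<sigma>) x)"
    by (rule sum.cong[OF refl])
  also have "\<dots> = (\<Sum>\<sigma>\<in>point_group \<Phi>. ?e \<sigma> x)"
    using point_group_bij[OF \<tau>]
    by (intro sum.reindex_bij_witness[where i = "\<lambda>\<sigma>. \<tau> \<circ> \<sigma>" and j = "\<lambda>\<sigma>. inv_into UNIV \<tau> \<circ> \<sigma>"])
      (auto simp: fun_eq_iff bij_is_inj bij_is_surj surj_f_inv_f
        intro: point_group_comp[OF \<tau>] point_group_comp[OF point_group_inv[OF \<tau>]])
  finally show ?thesis
    by (simp add: sym_exp_def)
qed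

lemma sum_mset_sum_swap:
  fixes f :: "'a \<Rightarrow> 'b \<Rightarrow> 'c::comm_monoid_add"
  shows "(\<Sum>x\<in>#M. \<Sum>s\<in>S. f x s) = (\<Sum>s\<in>S. \<Sum>x\<in>#M. f x s)"
  by (induction M) (auto simp: sum.distrib)

lemma cnj_sum_mset: "cnj (\<Sum>x\<in>#M. f x) = (\<Sum>x\<in>#M. cnj (f x))"
  by (induction M) auto

lemma Re_sum_mset: "Re (\<Sum>x\<in>#M. f x) = (\<Sum>x\<in>#M. Re (f x))"
  by (induction M) auto

lemma sum_mset_divide:
  fixes f :: "'a \<Rightarrow> 'b::field"
  shows "(\<Sum>x\<in>#M. f x / r) = (\<Sum>x\<in>#M. f x) / r"
  by (induction M) (auto simp: add_divide_distrib)

text \<open>With the diagonal included, the double sum for each \<open>\<sigma>\<close> is an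
  exponential sum times its conjugate. The nonnegativity of the result drives the lower bound on
  energies.\<close>

lemma pair_sum_sym_exp:
  "(\<Sum>x\<in>#M. \<Sum>y\<in>#M. sym_exp \<Phi> v (x - y)) = complex_of_real
     ((\<Sum>\<sigma>\<in>point_group \<Phi>. (norm (\<Sum>x\<in>#M. exp (2 * pi * \<i> * complex_of_real (\<sigma> v \<bullet> x))))\<^sup>2)
        / real (card (point_group \<Phi>)))"
proof -
  let ?e = "\<lambda>\<sigma> x. exp (2 * pi * \<i> * complex_of_real (\<sigma> v \<bullet> x))"
  have "(\<Sum>x\<in>#M. \<Sum>y\<in>#M. sym_exp \<Phi> v (x - y))
     = (\<Sum>\<sigma>\<in>point_group \<Phi>. \<Sum>x\<in>#M. \<Sum>y\<in>#M. ?e \<sigma> (x - y)) / of_nat (card (point_group \<Phi>))"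
    by (simp add: sym_exp_def sum_mset_divide sum_mset_sum_swap)
  also have "(\<lambda>\<sigma>. \<Sum>x\<in>#M. \<Sum>y\<in>#M. ?e \<sigma> (x - y))
     = (\<lambda>\<sigma>. complex_of_real ((norm (\<Sum>x\<in>#M. ?e \<sigma> x))\<^sup>2))"
  proof
    fix \<sigma>
    have "(\<Sum>x\<in>#M. \<Sum>y\<in>#M. ?e \<sigma> (x - y)) = (\<Sum>x\<in>#M. ?e \<sigma> x) * cnj (\<Sum>x\<in>#M. ?e \<sigma> x)"
      unfolding exp_inner_diff cnj_sum_mset by (simp only: sum_mset_product)
    then show "(\<Sum>x\<in>#M. \<Sum>y\<in>#M. ?e \<sigma> (x - y)) = complex_of_real ((norm (\<Sum>x\<in>#M. ?e \<sigma> x))\<^sup>2)"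
      by (simp only: complex_norm_square)
  qed
  finally show ?thesis by simp
qed

text \<open>The character given by \<open>u\<close> is trivial on \<open>\<Phi>\<close> but not at
  some \<open>w\<close> in \<open>L\<close>. Shifting by \<open>w\<close> permutes the cosets and
  multiplies the sum by a number other than 1.\<close>

lemma character_sum_zero:
  fixes \<Phi> L R :: "(real^'n) set"
  assumes "is_lattice \<Phi>" "is_lattice L" "\<Phi> \<subseteq> L" "coset_reps \<Phi> L R"
    and "u \<in> dual_lattice \<Phi>" "u \<notin> dual_lattice L"
  shows "(\<Sum>x\<in>R. exp (2 * pi * \<i> * complex_of_real (u \<bullet> x))) = 0"
proof -
  let ?e = "\<lambda>x. exp (2 * pi * \<i> * complex_of_real (u \<bullet> x))"
  have fin: "finite R"
    using finite_coset_reps assms(1-4) by blast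
  have RL: "R \<subseteq> L" and uniq: "\<And>x. x \<in> L \<Longrightarrow> \<exists>!y. y \<in> R \<and> x - y \<in> \<Phi>"
    using assms(4) unfolding coset_reps_def by auto
  obtain w where w: "w \<in> L" "u \<bullet> w \<notin> \<int>"
    using assms(6) unfolding dual_lattice_def by (auto simp: inner_commute)
  \<comment> \<open>The map \<open>p\<close> sends \<open>x\<close> to the representative of the
    coset of \<open>x + w\<close>.\<close>
  have "\<exists>y. y \<in> R \<and> x + w - y \<in> \<Phi>" if "x \<in> R" for x
    using uniq[of "x + w"] that RL w(1) lattice_add[OF assms(2)] by blast
  then obtain p where p: "\<And>x. x \<in> R \<Longrightarrow> p x \<in> R" "\<And>x. x \<in> R \<Longrightarrow> x + w - p x \<in> \<Phi>"
    by metis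
  have inj: "inj_on p R"
  proof
    fix x y assume xy: "x \<in> R" "y \<in> R" "p x = p y"
    then have "(x + w - p x) - (y + w - p y) \<in> \<Phi>"
      using p(2) lattice_diff[OF assms(1)] by blast
    then have "x - y \<in> \<Phi>" using xy by simp
    moreover have "x - x \<in> \<Phi>" using lattice_zero[OF assms(1)] by simp
    ultimately show "x = y"
      using xy uniq[of x] RL by blast
  qed
  have surj: "p ` R = R"
    using endo_inj_surj[OF fin _ inj] p(1) by blast
  have e: "?e (p x) = ?e x * ?e w" if "x \<in> R" for x
  proof -
    have "u \<bullet> (x + w - p x) \<in> \<int>"
      using assms(5) p(2)[OF that] by (simp add: dual_lattice_def inner_commute[of u])
    then have "?e (x + w - p x) = 1"
      by (simp only: exp_2pi_i_eq_1_iff)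
    moreover have "?e x * ?e w = ?e (x + w - p x) * ?e (p x)"
      by (simp add: inner_diff_right inner_add_right algebra_simps flip: exp_add)
    ultimately show ?thesis by simp
  qed
  have "(\<Sum>x\<in>R. ?e x) = (\<Sum>x\<in>R. ?e (p x))"
    using sum.reindex[OF inj, of ?e] surj by simp
  also have "\<dots> = (\<Sum>x\<in>R. ?e x) * ?e w"
    unfolding sum_distrib_right by (rule sum.cong[OF refl]) (rule e)
  finally have "(\<Sum>x\<in>R. ?e x) * (1 - ?e w) = 0"
    by (simp add: algebra_simps)
  moreover have "?e w \<noteq> 1"
    using w(2) by (simp only: exp_2pi_i_eq_1_iff not_False_eq_True)
  ultimately show ?thesis by simp
qed

text \<open>For \<open>r = m\<close> this identifies the frequencies at which the coefficients are
  assumed to vanish as the dual of \<open>(1/m) \<Lambda>\<close>.\<close>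

lemma dual_lattice_scaled:
  fixes L :: "(real^'n) set"
  assumes "r \<noteq> 0"
  shows "dual_lattice (scaled (1 / r) L) = scaled r (dual_lattice L)"
proof
  show "dual_lattice (scaled (1 / r) L) \<subseteq> scaled r (dual_lattice L)"
  proof
    fix v assume "v \<in> dual_lattice (scaled (1 / r) L)"
    then have "(1 / r) *\<^sub>R v \<in> dual_lattice L" "v = r *\<^sub>R ((1 / r) *\<^sub>R v)"
      using assms by (auto simp: dual_lattice_def scaled_def)
    then show "v \<in> scaled r (dual_lattice L)"
      unfolding scaled_def by blast
  qed
  show "scaled r (dual_lattice L) \<subseteq> dual_lattice (scaled (1 / r) L)"
    using assms by (auto simp: dual_lattice_def scaled_def)
qed

subsection \<open>Energies\<close>

lemma has_sum_sum_mset: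
  fixes f :: "'a \<Rightarrow> 'b \<Rightarrow> real"
  assumes "\<And>x. (f x has_sum s x) A"
  shows "((\<lambda>v. \<Sum>x\<in>#M. f x v) has_sum (\<Sum>x\<in>#M. s x)) A"
  using assms by (induction M) (auto intro: has_sum_add)

text \<open>A finite double sum commutes with a convergent series, and the constant term is counted
  once per ordered pair, diagonal included.\<close>

lemma pair_sum_infsum:
  fixes M :: "'a::ab_group_add multiset"
  assumes "\<And>z. (\<lambda>v. c v * h v z) summable_on A"
  shows "(\<Sum>x\<in>#M. \<Sum>y\<in>#M. c0 + (\<Sum>\<^sub>\<infinity>v\<in>A. c v * h v (x - y)))
     = c0 * real (size M) ^ 2 + (\<Sum>\<^sub>\<infinity>v\<in>A. c v * (\<Sum>x\<in>#M. \<Sum>y\<in>#M. h v (x - y)))"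
proof -
  have "((\<lambda>v. \<Sum>x\<in>#M. \<Sum>y\<in>#M. c v * h v (x - y)) has_sum
      (\<Sum>x\<in>#M. \<Sum>y\<in>#M. \<Sum>\<^sub>\<infinity>v\<in>A. c v * h v (x - y))) A"
    using assms by (intro has_sum_sum_mset has_sum_infsum)
  then have "(\<Sum>\<^sub>\<infinity>v\<in>A. c v * (\<Sum>x\<in>#M. \<Sum>y\<in>#M. h v (x - y)))
      = (\<Sum>x\<in>#M. \<Sum>y\<in>#M. \<Sum>\<^sub>\<infinity>v\<in>A. c v * h v (x - y))"
    by (simp add: infsumI sum_mset_distrib_left)
  then show ?thesis
    by (simp add: sum_mset.distrib power2_eq_square algebra_simps)
qed

lemma sum_mset_ereal: "(\<Sum>x\<in>#M. ereal (f x)) = ereal (\<Sum>x\<in>#M. f x)"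
  by (induction M) auto

text \<open>Restoring the removed copy of \<open>x\<close> in the inner sum adds \<open>g 0\<close>,
  once for each point counted with multiplicity.\<close>

lemma energy_ereal:
  "energy (\<lambda>x. ereal (g x)) M = ereal ((\<Sum>x\<in>#M. \<Sum>y\<in>#M. g (x - y)) - real (size M) * g 0)"
proof -
  have "(\<Sum>y\<in>#M - {#x#}. g (x - y)) = (\<Sum>y\<in>#M. g (x - y)) - g 0" if "x \<in># M" for x
  proof -
    have "M = add_mset x (M - {#x#})"
      using that by simp
    then have "(\<Sum>y\<in>#M. g (x - y)) = g (x - x) + (\<Sum>y\<in>#M - {#x#}. g (x - y))"
      by (metis image_mset_add_mset sum_mset.add_mset)
    then show ?thesis by simp
  qed
  then have "energy (\<lambda>x. ereal (g x)) M = ereal (\<Sum>x\<in>#M. (\<Sum>y\<in>#M. g (x - y)) - g 0)"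
    unfolding energy_def sum_mset_ereal by (metis (no_types, lifting) image_mset_cong)
  also have "(\<Sum>x\<in>#M. (\<Sum>y\<in>#M. g (x - y)) - g 0) = (\<Sum>x\<in>#M. \<Sum>y\<in>#M. g (x - y)) - real (size M) * g 0"
    using sum_mset.distrib[of "\<lambda>x. \<Sum>y\<in>#M. g (x - y)" "\<lambda>_. - g 0" M] by simp
  finally show ?thesis .
qed

lemma energy_mono:
  assumes "\<And>x. F x \<le> G x"
  shows "energy F M \<le> energy G M"
  unfolding energy_def using assms by (intro sum_mset_mono)

text \<open>All multiplicities are 1, so removing \<open>x\<close> leaves only points different from
  it. Hence \<open>F\<close> and \<open>G\<close> may differ at 0.\<close>

lemma energy_mset_set_cong:
  assumes "finite R" "\<And>x y. x \<in> R \<Longrightarrow> y \<in> R \<Longrightarrow> x \<noteq> y \<Longrightarrow> F (x - y) = G (x - y)"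
  shows "energy F (mset_set R) = energy G (mset_set R)"
proof -
  have inner: "(\<Sum>y\<in>#mset_set R - {#x#}. F (x - y)) = (\<Sum>y\<in>#mset_set R - {#x#}. G (x - y))"
    if "x \<in> R" for x
  proof -
    have "mset_set R - {#x#} = mset_set (R - {x})"
      using assms(1) that by (simp add: mset_set_Diff)
    then show ?thesis
      using assms that by (auto intro!: arg_cong[of _ _ sum_mset] image_mset_cong)
  qed
  show ?thesis
    unfolding energy_def
    by (rule arg_cong[where f = sum_mset, OF image_mset_cong]) (simp add: assms(1) inner)
qed

theorem corollary13:
  fixes \<Phi> \<Lambda> W \<Delta> R :: "(real^'n) set"
    and F :: "real^'n \<Rightarrow> ereal"
    and a :: "real^'n"
    and c :: "real^'n \<Rightarrow> real"
    and m :: nat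
  assumes "is_lattice \<Phi>"
    and "reflection_group \<subseteq> point_group \<Phi>"
    and "\<And>x. F x \<noteq> -\<infinity>"
    and "\<And>f x. f \<in> isometry_group \<Phi> \<Longrightarrow> F (f x) = F x"
    and "\<And>i. a $ i > 0"
    and "rect_lattice a \<subseteq> \<Phi>"
    and "fundamental_domain (point_group \<Phi>) (dual_lattice \<Phi>) W"
    and "fundamental_domain (isometry_group \<Phi>) UNIV \<Delta>"
    and "\<And>v. v \<in> W \<Longrightarrow> v \<noteq> 0 \<Longrightarrow> c v \<ge> 0"
    and "c summable_on W"
    and "\<And>t. t \<in> cos_map a ` \<Delta> \<Longrightarrow> ereal (lp_function \<Phi> a W c t) \<le> tilde a F t"
    and "is_lattice \<Lambda>"
    and "\<Phi> \<subseteq> \<Lambda>"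
    and "point_group \<Phi> \<subseteq> point_group \<Lambda>"
    and "m \<ge> 1"
    and "coset_reps \<Phi> (scaled (1 / real m) \<Lambda>) R"
    and "\<And>v. v \<in> scaled (real m) (dual_lattice \<Lambda>) \<inter> W \<Longrightarrow> v \<noteq> 0 \<Longrightarrow> c v = 0"
    and "\<And>t. t \<in> cos_map a ` (scaled (1 / real m) \<Lambda> \<inter> \<Delta>) - {\<chi> i. 1} \<Longrightarrow>
           ereal (lp_function \<Phi> a W c t) = tilde a F t"
  shows "finite R \<and> F_optimal F (mset_set R)"
proof -
  note lat\<Phi> = assms(1) and refl\<Phi> = assms(2) and F_inv = assms(4) and a_pos = assms(5)
    and rect = assms(6) and domW = assms(7) and dom\<Delta> = assms(8) and c_nonneg = assms(9)
    and c_sum = assms(10) and lp_le = assms(11) and lat\<Lambda> = assms(12) and G_sub = assms(14)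
    and m = assms(15) and reps = assms(16) and c_zero = assms(17) and lp_eq = assms(18)
  define L where "L = scaled (1 / real m) \<Lambda>"
  define g where "g = (\<lambda>x. c 0 + (\<Sum>\<^sub>\<infinity>v\<in>W - {0}. c v * Re (sym_exp \<Phi> v x)))"
  have latL: "is_lattice L"
    unfolding L_def using lat\<Lambda> m by (intro is_lattice_scaled) auto
  have \<Phi>L: "\<Phi> \<subseteq> L"
    unfolding L_def using assms(13) lattice_subset_scaled[OF lat\<Lambda> m] by blast
  have repsL: "coset_reps \<Phi> L R"
    using reps by (simp add: L_def)
  have finR: "finite R"
    using finite_coset_reps[OF lat\<Phi> latL \<Phi>L repsL] .
  have W_dual: "v \<in> dual_lattice \<Phi>" if "v \<in> W" for v
    using domW that by (auto simp: fundamental_domain_def)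

  \<comment> \<open>From the cube to the whole space\<close>
  have g_inv: "g (f x) = g x" if "f \<in> isometry_group \<Phi>" for f x
    unfolding g_def using sym_exp_isometry_invariant[OF lat\<Phi> W_dual that]
    by (auto intro!: infsum_cong)
  have lp_tilde: "lp_function \<Phi> a W c = tilde a g"
    by (intro ext) (simp only: lp_function_def lattice_poly_def tilde_def g_def)
  have lp_g: "lp_function \<Phi> a W c (cos_map a x) = g x" for x
    unfolding lp_tilde using lat\<Phi> refl\<Phi> a_pos rect
    by (rule tilde_cos_map[where a = a and h = g]) (rule g_inv)
  have tilde_F: "tilde a F (cos_map a x) = F x" for x
    using lat\<Phi> refl\<Phi> a_pos rect
    by (rule tilde_cos_map[where a = a and h = F]) (rule F_inv)
  have to_\<Delta>: "\<exists>f\<in>isometry_group \<Phi>. f x \<in> \<Delta>" for x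
    using dom\<Delta> unfolding fundamental_domain_def by blast

  have g_le_F: "ereal (g x) \<le> F x" for x
  proof -
    obtain f where f: "f \<in> isometry_group \<Phi>" "f x \<in> \<Delta>"
      using to_\<Delta> by blast
    then have "ereal (g (f x)) \<le> F (f x)"
      using lp_le[of "cos_map a (f x)"] by (simp add: lp_g tilde_F)
    then show ?thesis
      by (simp add: g_inv[OF f(1)] F_inv[OF f(1)])
  qed
  \<comment> \<open>An isometry \<open>f\<close> moves \<open>x\<close> into
    \<open>\<Delta>\<close>. It keeps \<open>x\<close> in \<open>L\<close>, as
    \<open>\<sigma>\<close> preserves \<open>\<Lambda>\<close> and \<open>b\<close> lies in
    \<open>L\<close>, and outside \<open>\<Phi>\<close>, so the image in the cube is not the corner
    and the equality hypothesis applies.\<close>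
  have F_eq_g: "F x = ereal (g x)" if x: "x \<in> L" "x \<notin> \<Phi>" for x
  proof -
    obtain f where f: "f \<in> isometry_group \<Phi>" "f x \<in> \<Delta>"
      using to_\<Delta> by blast
    obtain \<sigma> b where \<sigma>: "\<sigma> \<in> point_group \<Phi>" "b \<in> \<Phi>" "\<And>x. f x = \<sigma> x + b"
      by (rule isometry_group_decompose[OF lat\<Phi> f(1)]) (rule that)
    have "\<sigma> x \<in> L"
      using point_group_scaled[of \<sigma> \<Lambda> x] \<sigma>(1) G_sub x(1) by (auto simp: L_def)
    then have "f x \<in> L"
      using \<sigma> \<Phi>L lattice_add[OF latL] by auto
    moreover have "f x \<notin> \<Phi>"
    proof
      assume "f x \<in> \<Phi>"
      then have "\<sigma> x \<in> \<sigma> ` \<Phi>"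
        using lattice_diff[OF lat\<Phi> _ \<sigma>(2), of "f x"] \<sigma>(3) point_group_image[OF \<sigma>(1)] by simp
      then show False
        using x(2) point_group_bij[OF \<sigma>(1)] by (simp add: bij_is_inj inj_image_mem_iff)
    qed
    then have "cos_map a (f x) \<noteq> (\<chi> i. 1)"
      using cos_map_eq_1_imp[where a = a, OF a_pos] rect by blast
    ultimately have "ereal (g (f x)) = F (f x)"
      using lp_eq[of "cos_map a (f x)"] f(2) by (auto simp: lp_g tilde_F L_def)
    then show ?thesis
      by (simp add: g_inv[OF f(1)] F_inv[OF f(1)])
  qed

  \<comment> \<open>Convergence and the energy of the series\<close>
  have summable: "(\<lambda>v. c v * Re (sym_exp \<Phi> v z)) summable_on (W - {0})" for z
  proof (rule Infinite_Sum.abs_summable_summable, rule Infinite_Sum.abs_summable_on_comparison_test')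
    show "c summable_on (W - {0})"
      using c_sum by (rule summable_on_subset_banach) auto
    \<comment> \<open>The coefficients themselves are the majorant; they are nonnegative away from
      the frequency 0.\<close>
    show "norm (c v * Re (sym_exp \<Phi> v z)) \<le> c v" if "v \<in> W - {0}" for v
    proof -
      have "\<bar>Re (sym_exp \<Phi> v z)\<bar> \<le> 1"
        using abs_Re_le_cmod[of "sym_exp \<Phi> v z"] norm_sym_exp_le_1[of \<Phi> v z] by linarith
      then show ?thesis
        using c_nonneg[of v] that by (simp add: abs_mult mult_left_le)
    qed
  qed
  \<comment> \<open>\<open>Q M v\<close> is the contribution of the frequency \<open>v\<close> over
    all ordered pairs from \<open>M\<close>, diagonal included.\<close>
  define Q where "Q = (\<lambda>M v. \<Sum>x\<in>#M. \<Sum>y\<in>#M. Re (sym_exp \<Phi> v (x - y)))"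
  have Q: "Q M v = (\<Sum>\<sigma>\<in>point_group \<Phi>. (norm (\<Sum>x\<in>#M. exp (2 * pi * \<i> * complex_of_real (\<sigma> v \<bullet> x))))\<^sup>2)
        / real (card (point_group \<Phi>))" for M v
    unfolding Q_def Re_sum_mset[symmetric] pair_sum_sym_exp by simp
  have energy_g: "energy (\<lambda>x. ereal (g x)) M = ereal
      (c 0 * real (size M) ^ 2 + (\<Sum>\<^sub>\<infinity>v\<in>W - {0}. c v * Q M v) - real (size M) * g 0)" for M
    unfolding energy_ereal unfolding g_def[THEN fun_cong, of "_ - _"] Q_def
    by (simp add: pair_sum_infsum[where c = c and h = "\<lambda>v z. Re (sym_exp \<Phi> v z)", OF summable])

  \<comment> \<open>Either \<open>c v\<close> is 0, or \<open>v\<close> is not dual to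
    \<open>L\<close>. In the second case no \<open>\<sigma> v\<close> is dual to \<open>L\<close>
    either, because \<open>\<sigma>\<close> preserves \<open>L\<close>, and all exponential sums
    over \<open>R\<close> vanish.\<close>
  have Q_R: "c v * Q (mset_set R) v = 0" if v: "v \<in> W - {0}" for v
  proof (cases "c v = 0")
    case False
    then have nv: "v \<notin> dual_lattice L"
      using v c_zero[of v] m by (auto simp: L_def dual_lattice_scaled)
    have "(\<Sum>x\<in>R. exp (2 * pi * \<i> * complex_of_real (\<sigma> v \<bullet> x))) = 0"
      if \<sigma>: "\<sigma> \<in> point_group \<Phi>" for \<sigma>
    proof (rule character_sum_zero[OF lat\<Phi> latL \<Phi>L repsL])
      show "\<sigma> v \<in> dual_lattice \<Phi>"
        using point_group_dual[OF \<sigma> W_dual] v by blast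
      show "\<sigma> v \<notin> dual_lattice L"
      proof
        assume dual: "\<sigma> v \<in> dual_lattice L"
        have "w \<bullet> v \<in> \<int>" if "w \<in> L" for w
        proof -
          have "\<sigma> w \<in> L"
            using point_group_scaled[of \<sigma> \<Lambda> w] \<sigma> G_sub that by (auto simp: L_def)
          then have "\<sigma> w \<bullet> \<sigma> v \<in> \<int>"
            using dual by (simp add: dual_lattice_def)
          then show ?thesis
            by (simp add: point_group_inner[OF \<sigma>])
        qed
        then show False
          using nv by (simp add: dual_lattice_def)
      qed
    qed
    then show ?thesis
      by (simp add: Q flip: sum_unfold_sum_mset)
  qed simp

  \<comment> \<open>Comparison of the energies\<close>
  have "F_optimal F (mset_set R)"
    unfolding F_optimal_def
  proof (intro allI impI)
    fix M :: "(real^'n) multiset"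
    assume size: "size M = size (mset_set R)"
    have "energy F (mset_set R) = energy (\<lambda>x. ereal (g x)) (mset_set R)"
    proof (rule energy_mset_set_cong[OF finR])
      fix x y assume xy: "x \<in> R" "y \<in> R" "x \<noteq> y"
      have "x \<in> L" "y \<in> L" "x - x \<in> \<Phi>"
        using xy repsL lattice_zero[OF lat\<Phi>] by (auto simp: coset_reps_def)
      \<comment> \<open>The unique representative of the coset of \<open>x\<close> is
        \<open>x\<close> itself, so \<open>x - y\<close> in \<open>\<Phi>\<close> would force
        \<open>y = x\<close>.\<close>
      moreover from this have "x - y \<notin> \<Phi>"
        using xy repsL unfolding coset_reps_def by blast
      ultimately show "F (x - y) = ereal (g (x - y))"
        by (intro F_eq_g lattice_diff[OF latL])
    qed
    \<comment> \<open>The series vanishes term by term at \<open>R\<close>. What remains depends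
      only on the number of points, so it can be written with \<open>size M\<close>.\<close>
    also have "\<dots> = ereal (c 0 * real (size M) ^ 2 - real (size M) * g 0)"
      unfolding energy_g size using infsum_0[of "W - {0}", OF Q_R] by simp
    also have "\<dots> \<le> energy (\<lambda>x. ereal (g x)) M"
    proof -
      \<comment> \<open>For an arbitrary \<open>M\<close> the series can only raise the energy,
        since each \<open>Q M v\<close> is an average of squares.\<close>
      have "(\<Sum>\<^sub>\<infinity>v\<in>W - {0}. c v * Q M v) \<ge> 0"
        using c_nonneg by (intro infsum_nonneg mult_nonneg_nonneg) (auto simp: Q intro!: divide_nonneg_nonneg sum_nonneg)
      then show ?thesis
        unfolding energy_g by simp
    qed
    also have "\<dots> \<le> energy F M"
      using g_le_F by (rule energy_mono)
    finally show "energy F (mset_set R) \<le> energy F M" .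
  qed
  then show ?thesis
    using finR by blast
qed

end
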